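(* Let $r>1$, let $R=\Phi\langle x_1,\ldots,x_r\rangle$ be the free associative algebra over a field $\Phi$, and let $\alpha:\mathbb{N}\to\mathbb{R}_{\ge0}$ be a function satisfying $\alpha(n)\to0$ as $n\to\infty$. Then there is a cyclic right $R$-module $M=\varepsilon_1R$ with a cyclic submodule $N$ such that the growths of $N$ and $M/N$ are linear, while for the growth function of $M$ we have $g_{\varepsilon_1,M}(n)>\alpha(n)r^n$ for all sufficiently large $n$.
   Context: $R(n)$ is the span of all monomials of degree at most $n$ in $R$. The growth function of a cyclic module $V=aR$ with respect to the generator $a$ is $g_{a,V}(n)=\dim_\Phi(aR(n))$. The growth of $V$ is linear if there are constants $c,C>0$ such that $cn\le g_{a,V}(n)\le Cn$ for all sufficiently large $n$. *)

theory Defs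
  imports
    Complex_Main
    "HOL-Library.Cardinality"
    "HOL-Library.Poly_Mapping"
    "HOL-Algebra.AbelCoset"
    "Jordan_Normal_Form.VS_Connect"
begin

section \<open>The free associative algebra\<close>

text \<open>
  Words over the alphabet \<open>'x\<close> form the free monoid on \<open>'x\<close>, written additively because the
  convolution product of \<^theory>\<open>HOL-Library.Poly_Mapping\<close> expects an additive monoid of exponents.
  Accordingly \<open>('x, 'a) free_alg\<close> is the monoid algebra of the free monoid, that is, the free
  associative unital algebra over \<open>'a\<close> on the generators \<open>'x\<close>; when \<open>'x\<close> is finite it has
  \<open>CARD('x)\<close> generators. The monomial \<open>w\<close> is \<open>Poly_Mapping.single w 1\<close> and the scalar \<open>c\<close> is
  \<open>Poly_Mapping.single 0 c\<close>.
\<close>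

datatype 'x word = Word (letters: "'x list")

instantiation word :: (type) monoid_add
begin

definition zero_word :: "'x word" where
  "zero_word = Word []"

definition plus_word :: "'x word \<Rightarrow> 'x word \<Rightarrow> 'x word" where
  "plus_word v w = Word (letters v @ letters w)"

instance
  by standard (simp_all add: zero_word_def plus_word_def)

end

type_synonym ('x, 'a) free_alg = "'x word \<Rightarrow>\<^sub>0 'a"

definition free_alg_space :: "('a::field, ('x, 'a) free_alg) module" where
  "free_alg_space =
    \<lparr>carrier = UNIV, mult = (*), one = 1, zero = 0, add = (+),
     smult = (\<lambda>c f. Poly_Mapping.single 0 c * f)\<rparr>"

definition deg_le :: "nat \<Rightarrow> ('x, 'a::field) free_alg set" where
  "deg_le n = LinearCombinations.module.span class_ring free_alg_space
    {Poly_Mapping.single w 1 | w. length (letters w) \<le> n}"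

section \<open>Right modules\<close>

text \<open>
  The \<open>module\<close> locale of HOL-Algebra covers left modules over commutative rings only. A right module
  is stored in the same record type, with \<open>f \<odot> x\<close> standing for \<open>x\<close> acted on by \<open>f\<close> from the right;
  this is visible in the order of the factors in \<open>rsmult_assoc\<close>. The fields \<open>mult\<close> and \<open>one\<close> of the
  record play no role.
\<close>

locale right_module = R?: ring R + M?: abelian_group M
  for R :: "('r, 'c) ring_scheme" (structure) and M :: "('r, 'm, 'd) module_scheme" (structure) +
  assumes rsmult_closed:
      "\<lbrakk>f \<in> carrier R; x \<in> carrier M\<rbrakk> \<Longrightarrow> f \<odot>\<^bsub>M\<^esub> x \<in> carrier M"
    and rsmult_distr_ring:
      "\<lbrakk>f \<in> carrier R; g \<in> carrier R; x \<in> carrier M\<rbrakk>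
        \<Longrightarrow> (f \<oplus>\<^bsub>R\<^esub> g) \<odot>\<^bsub>M\<^esub> x = f \<odot>\<^bsub>M\<^esub> x \<oplus>\<^bsub>M\<^esub> g \<odot>\<^bsub>M\<^esub> x"
    and rsmult_distr_module:
      "\<lbrakk>f \<in> carrier R; x \<in> carrier M; y \<in> carrier M\<rbrakk>
        \<Longrightarrow> f \<odot>\<^bsub>M\<^esub> (x \<oplus>\<^bsub>M\<^esub> y) = f \<odot>\<^bsub>M\<^esub> x \<oplus>\<^bsub>M\<^esub> f \<odot>\<^bsub>M\<^esub> y"
    and rsmult_assoc:
      "\<lbrakk>f \<in> carrier R; g \<in> carrier R; x \<in> carrier M\<rbrakk>
        \<Longrightarrow> (f \<otimes>\<^bsub>R\<^esub> g) \<odot>\<^bsub>M\<^esub> x = g \<odot>\<^bsub>M\<^esub> (f \<odot>\<^bsub>M\<^esub> x)"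
    and rsmult_one:
      "x \<in> carrier M \<Longrightarrow> \<one>\<^bsub>R\<^esub> \<odot>\<^bsub>M\<^esub> x = x"

text \<open>
  \<open>orbit M a S\<close> is the set \<open>aS\<close>, so \<open>orbit M a (carrier R)\<close> is the cyclic submodule \<open>aR\<close>. The free
  algebra is the ring \<open>class_ring\<close> on the whole type, whose carrier is \<open>UNIV\<close>.

  A module over a finitely generated free algebra that is generated by one element has countable
  dimension over the base field \<open>'a\<close>; hence it is isomorphic to one whose carrier is a subset of
  \<open>nat \<Rightarrow>\<^sub>0 'a\<close>. Existence of a cyclic module up to isomorphism therefore means existence of one
  carried by that type, with arbitrary carrier set and operations.
\<close>

definition orbit :: "('r, 'm) module \<Rightarrow> 'm \<Rightarrow> 'r set \<Rightarrow> 'm set" where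
  "orbit M a S = (\<lambda>f. f \<odot>\<^bsub>M\<^esub> a) ` S"

definition cyclic_submodule :: "('r, 'm) module \<Rightarrow> 'm \<Rightarrow> ('r, 'm) module" where
  "cyclic_submodule M a = M\<lparr>carrier := orbit M a UNIV\<rparr>"

definition quotient_module :: "('r, 'm) module \<Rightarrow> 'm set \<Rightarrow> ('r, 'm set) module" where
  "quotient_module M N =
    \<lparr>carrier = a_rcosets\<^bsub>M\<^esub> N, mult = (\<lambda>_ _. N), one = N, zero = N, add = set_add M,
     smult = (\<lambda>f X. \<Union>x\<in>X. N +>\<^bsub>M\<^esub> (f \<odot>\<^bsub>M\<^esub> x))\<rparr>"

section \<open>Growth\<close>

definition restrict_scalars ::
    "(('x, 'a::field) free_alg, 'm) module \<Rightarrow> ('a, 'm) module" where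
  "restrict_scalars M =
    \<lparr>carrier = carrier M, mult = mult M, one = one M, zero = zero M, add = add M,
     smult = (\<lambda>c x. Poly_Mapping.single 0 c \<odot>\<^bsub>M\<^esub> x)\<rparr>"

text \<open>
  \<open>vectorspace.dim\<close> is meaningful for finite dimensional spaces only. For finite \<open>'x\<close> the space
  \<open>deg_le n\<close> is spanned by finitely many monomials, so \<open>growth\<close> stays within that range.
\<close>

definition growth :: "(('x, 'a::field) free_alg, 'm) module \<Rightarrow> 'm \<Rightarrow> nat \<Rightarrow> nat" where
  "growth V a n =
    vectorspace.dim class_ring ((restrict_scalars V)\<lparr>carrier := orbit V a (deg_le n)\<rparr>)"

definition linear_growth :: "(('x, 'a::field) free_alg, 'm) module \<Rightarrow> 'm \<Rightarrow> bool" where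
  "linear_growth V a \<longleftrightarrow>
    (\<exists>c C :: real. c > 0 \<and> C > 0 \<and>
      (\<forall>\<^sub>F n in sequentially. c * real n \<le> real (growth V a n) \<and> real (growth V a n) \<le> C * real n))"

end

theory Submission
  imports Defs
begin

text \<open>
  Let the free monoid act on a set and linearize: the growth of a basis vector then counts the
  points reachable by words of bounded length. The set consists of points $f_i$ and $e_i$, and the
  letters are numbered $0, \dots, r - 1$. Letter 0 shifts both sequences by one, and every letter
  moves $e_i$ to some $e_j$ with $j \le i + 1$. Hence the span $N$ of the $e_i$ has linear growth
  with respect to $b = e_0$, although the restriction on the letters still allows, for each $m$, a
  point $e_k$ on which the words of length $m$ act injectively. A nonzero letter takes $f_i$ to such
  a point, for a length $m = \mu(i)$. The quotient by $N$ is spanned by the $f_i$ and so has linear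
  growth, while going along the $f$-sequence to $f_i$ and leaving it there costs only $i + 1$ letters:
  the growth of $f_0$ at $n$ is at least $r^{n - i - 1}$ as long as $n - i - 1 \le \mu(i)$. If $\mu$
  grows fast enough, this can be used at $n$ with $i$ so small that $\alpha(n) < r^{-i-1}$.
\<close>

section \<open>Linear extensions\<close>

lemma lookup_single_0_times:
  fixes f :: "'k::monoid_add \<Rightarrow>\<^sub>0 'a::semiring_0"
  shows "Poly_Mapping.lookup (Poly_Mapping.single 0 c * f) k = c * Poly_Mapping.lookup f k"
  unfolding mult_map_scale_conv_mult[symmetric] by (simp add: Poly_Mapping.map.rep_eq when_def)

lemma keys_single_add:
  fixes f :: "'k \<Rightarrow>\<^sub>0 'a::comm_monoid_add"
  assumes "k \<notin> Poly_Mapping.keys f"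
  shows "Poly_Mapping.keys (Poly_Mapping.single k c + f) =
    Poly_Mapping.keys (Poly_Mapping.single k c) \<union> Poly_Mapping.keys f"
  using assms by (auto simp: in_keys_iff lookup_add lookup_single when_def split: if_splits)

text \<open>Linear maps respect sums but not \<open>update\<close>, hence this form. Freshness of
  \<open>k\<close> excludes cancellation, so by \<open>keys_single_add\<close> a bound on the
  support of the sum passes to both summands. The coefficient \<open>c\<close> may be 0, and then
  \<open>k\<close> need not satisfy the bound; later proofs treat this case separately.\<close>

lemma poly_mapping_additive_induct [case_names zero single_add]:
  fixes f :: "'k \<Rightarrow>\<^sub>0 'a::comm_monoid_add"
  assumes zero: "P 0"
    and single_add: "\<And>k c f. k \<notin> Poly_Mapping.keys f \<Longrightarrow> P f \<Longrightarrow> P (Poly_Mapping.single k c + f)"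
  shows "P f"
proof (induction f rule: update_induct)
  case const
  show ?case by (fact zero)
next
  case (update f k c)
  have "Poly_Mapping.update k c f = Poly_Mapping.single k c + f"
    using update by (intro poly_mapping_eqI)
      (auto simp: lookup_update lookup_add lookup_single when_def in_keys_iff)
  then show ?case using single_add update by simp
qed

text \<open>Scalar multiplication is written as convolution with
  \<open>Poly_Mapping.single 0 c\<close>, the form in which scalars occur in
  \<open>free_alg_space\<close> and \<open>restrict_scalars\<close>. This is why the indices form a
  monoid even where they merely label points.\<close>

definition lin_ext :: "('i \<Rightarrow> ('k::monoid_add \<Rightarrow>\<^sub>0 'a)) \<Rightarrow> ('i \<Rightarrow>\<^sub>0 'a) \<Rightarrow> ('k \<Rightarrow>\<^sub>0 'a::semiring_0)"
  where "lin_ext g x =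
    (\<Sum>i\<in>Poly_Mapping.keys x. Poly_Mapping.single 0 (Poly_Mapping.lookup x i) * g i)"

lemma lin_ext_eq_sum:
  assumes "finite S" "Poly_Mapping.keys x \<subseteq> S"
  shows "lin_ext g x = (\<Sum>i\<in>S. Poly_Mapping.single 0 (Poly_Mapping.lookup x i) * g i)"
  unfolding lin_ext_def using assms
  by (intro sum.mono_neutral_left) (auto simp: in_keys_iff)

lemma lin_ext_0 [simp]: "lin_ext g 0 = 0"
  by (simp add: lin_ext_def)

lemma lin_ext_single [simp]:
  "lin_ext g (Poly_Mapping.single i c) = Poly_Mapping.single 0 c * g i"
  by (subst lin_ext_eq_sum[of "{i}"]) auto

lemma lin_ext_add: "lin_ext g (x + y) = lin_ext g x + lin_ext g y"
proof -
  let ?S = "Poly_Mapping.keys x \<union> Poly_Mapping.keys y"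
  have "Poly_Mapping.keys (x + y) \<subseteq> ?S" by (rule keys_add)
  then show ?thesis
    by (simp add: lin_ext_eq_sum[of ?S] lookup_add single_add distrib_right sum.distrib)
qed

lemma lin_ext_scale:
  fixes x :: "'i::monoid_add \<Rightarrow>\<^sub>0 'a::semiring_0"
  shows "lin_ext g (Poly_Mapping.single 0 c * x) = Poly_Mapping.single 0 c * lin_ext g x"
proof -
  have "Poly_Mapping.keys (Poly_Mapping.single 0 c * x) \<subseteq> Poly_Mapping.keys x"
    by (auto simp: in_keys_iff lookup_single_0_times)
  then show ?thesis
    by (simp add: lin_ext_eq_sum[of "Poly_Mapping.keys x"] lookup_single_0_times sum_distrib_left
        mult_single mult.assoc[symmetric])
qed

lemma lin_ext_add_fun: "lin_ext (\<lambda>i. g i + h i) x = lin_ext g x + lin_ext h x"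
  by (simp add: lin_ext_def distrib_left sum.distrib)

lemma keys_lin_ext:
  "Poly_Mapping.keys (lin_ext g x) \<subseteq> (\<Union>i\<in>Poly_Mapping.keys x. Poly_Mapping.keys (g i))"
proof -
  have "Poly_Mapping.keys (Poly_Mapping.single 0 (Poly_Mapping.lookup x i) * g i) \<subseteq>
      Poly_Mapping.keys (g i)" for i
    by (auto simp: in_keys_iff lookup_single_0_times)
  then show ?thesis
    unfolding lin_ext_def by (intro order_trans[OF keys_sum] UN_mono order_refl)
qed

section \<open>Elements of bounded degree\<close>

lemma module_free_alg_space:
  "Module.module class_ring (free_alg_space :: ('a::field, ('x, 'a) free_alg) module)"
proof -
  have "abelian_group (free_alg_space :: ('a, ('x, 'a) free_alg) module)"
    by (rule abelian_groupI)
      (auto simp: free_alg_space_def add.assoc intro: add.commute add.left_inverse)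
  then show ?thesis
    unfolding Module.module_def module_axioms_def
    by (auto simp: free_alg_space_def single_add distrib_left distrib_right
        mult_single mult.assoc[symmetric] class_cring.cring_axioms)
qed

lemma deg_le_eq:
  "(deg_le n :: ('x, 'a::field) free_alg set) =
    {f. Poly_Mapping.keys f \<subseteq> {w. length (letters w) \<le> n}}"
  (is "_ = ?D")
proof
  interpret Module.module class_ring "free_alg_space :: ('a, ('x, 'a) free_alg) module"
    by (rule module_free_alg_space)
  let ?S = "{Poly_Mapping.single w 1 | w. length (letters w) \<le> n} :: ('x, 'a) free_alg set"
  have "submodule class_ring ?D free_alg_space"
  proof (rule submodule.intro)
    fix f g :: "('x, 'a) free_alg" assume "f \<in> ?D" "g \<in> ?D"
    then show "f \<oplus>\<^bsub>free_alg_space\<^esub> g \<in> ?D"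
      using keys_add[of f g] by (auto simp: free_alg_space_def)
  qed (use module_axioms in \<open>auto simp: free_alg_space_def in_keys_iff lookup_single_0_times\<close>)
  then show "deg_le n \<subseteq> ?D"
    unfolding deg_le_def by (intro span_is_subset) auto
  have sub: "submodule class_ring (span ?S) free_alg_space"
    by (rule span_is_submodule) (simp add: free_alg_space_def)
  have gen: "?S \<subseteq> span ?S"
    by (rule in_own_span) (simp add: free_alg_space_def)
  have "Poly_Mapping.keys f \<subseteq> {w. length (letters w) \<le> n} \<Longrightarrow> f \<in> span ?S" for f
  proof (induction f rule: poly_mapping_additive_induct)
    case zero
    then show ?case using submodule.zero_closed[OF sub] by (simp add: free_alg_space_def)
  next
    case (single_add w c f)
    have keys: "Poly_Mapping.keys (Poly_Mapping.single w c + f) =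
      Poly_Mapping.keys (Poly_Mapping.single w c) \<union> Poly_Mapping.keys f"
      using single_add(1) by (rule keys_single_add)
    have "Poly_Mapping.single w c \<in> span ?S"
    proof (cases "c = 0")
      case True
      then show ?thesis using submodule.zero_closed[OF sub] by (simp add: free_alg_space_def)
    next
      case False
      then have "Poly_Mapping.single w 1 \<in> ?S" using single_add keys by auto
      then have "c \<odot>\<^bsub>free_alg_space\<^esub> Poly_Mapping.single w 1 \<in> span ?S"
        using gen by (intro submodule.smult_closed[OF sub]) auto
      then show ?thesis by (simp add: free_alg_space_def mult_single)
    qed
    moreover have "f \<in> span ?S" using single_add keys by auto
    ultimately show ?case
      using submodule.m_closed[OF sub] by (simp add: free_alg_space_def)
  qed
  then show "?D \<subseteq> deg_le n" unfolding deg_le_def by auto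
qed

section \<open>Dimension of coordinate subspaces\<close>

text \<open>The images under \<open>h\<close> of the unit vectors at \<open>A\<close> form a basis.
  The map \<open>h\<close> lets one lemma serve both the orbits in a module (\<open>h = id\<close>)
  and those in a quotient (\<open>h\<close> the coset map). The vector space axioms for
  \<open>V\<close> are transported along \<open>h\<close> instead of being assumed.\<close>

lemma dim_coordinate_space:
  fixes V :: "('a::field, 'v) module" and h :: "('k::monoid_add \<Rightarrow>\<^sub>0 'a) \<Rightarrow> 'v"
  assumes finA: "finite A"
    and bij: "bij_betw h {x. Poly_Mapping.keys x \<subseteq> A} (carrier V)"
    and zero: "\<zero>\<^bsub>V\<^esub> = h 0"
    and add: "\<And>x y. h x \<oplus>\<^bsub>V\<^esub> h y = h (x + y)"
    and smult: "\<And>c x. c \<odot>\<^bsub>V\<^esub> h x = h (Poly_Mapping.single 0 c * x)"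
  shows "vectorspace.dim class_ring V = card A"
proof -
  let ?W = "{x :: 'k \<Rightarrow>\<^sub>0 'a. Poly_Mapping.keys x \<subseteq> A}"
  have car: "carrier V = h ` ?W" and inj: "inj_on h ?W"
    using bij by (auto simp: bij_betw_def)
  have W_add: "x + y \<in> ?W" if "x \<in> ?W" "y \<in> ?W" for x y
    using that keys_add[of x y] by auto
  have W_scale: "Poly_Mapping.single 0 c * x \<in> ?W" if "x \<in> ?W" for x c
    using that by (auto simp: in_keys_iff lookup_single_0_times)
  have W_minus: "- x \<in> ?W" if "x \<in> ?W" for x
    using that by (auto simp: in_keys_iff)
  have "abelian_group V"
  proof (rule abelian_groupI)
    fix v assume "v \<in> carrier V"
    then obtain x where "x \<in> ?W" "v = h x" unfolding car by blast
    then show "\<exists>u\<in>carrier V. u \<oplus>\<^bsub>V\<^esub> v = \<zero>\<^bsub>V\<^esub>"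
      using W_minus[of x] unfolding car by (intro bexI[of _ "h (- x)"]) (auto simp: add zero)
  qed (use W_add in \<open>auto simp: car add zero add_ac\<close>)
  then have "Module.module class_ring V"
    unfolding Module.module_def module_axioms_def using W_scale
    by (auto simp: car add smult single_add distrib_left distrib_right
        mult_single mult.assoc[symmetric] class_cring.cring_axioms)
  then interpret vectorspace class_ring V
    by (simp add: vectorspace_def class_field)
  define e where "e i = h (Poly_Mapping.single i 1)" for i
  have eW: "Poly_Mapping.single i c \<in> ?W" if "i \<in> A" for i c
    using that by auto
  have inj_e: "inj_on e A"
  proof (rule inj_onI)
    fix i j assume "i \<in> A" "j \<in> A" "e i = e j"
    then have "Poly_Mapping.single i (1::'a) = Poly_Mapping.single j 1"
      unfolding e_def using eW inj by (meson inj_onD)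
    then show "i = j" by (metis keys_single one_neq_zero singleton_inject)
  qed
  have e_car: "e ` A \<subseteq> carrier V" unfolding e_def car using eW by auto
  have lincomb: "lincomb c (e ` B) = h (\<Sum>i\<in>B. Poly_Mapping.single i (c (e i)))"
    if "B \<subseteq> A" for c B
    using finite_subset[OF that finA] that
  proof (induction B rule: finite_induct)
    case empty
    then show ?case by (simp add: lincomb_def zero)
  next
    case (insert i B)
    have "e i \<notin> e ` B" using insert inj_e by (auto dest: inj_onD)
    moreover have "(\<lambda>v. c v \<odot>\<^bsub>V\<^esub> v) \<in> e ` B \<rightarrow> carrier V" "c (e i) \<odot>\<^bsub>V\<^esub> e i \<in> carrier V"
      using e_car insert by (auto intro!: smult_closed)
    moreover have "c (e i) \<odot>\<^bsub>V\<^esub> e i = h (Poly_Mapping.single i (c (e i)))"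
      by (subst (2) e_def) (simp add: smult mult_single)
    ultimately show ?case
      using insert by (simp add: lincomb_def add)
  qed
  have "lin_indpt (e ` A)"
  proof (rule finite_lin_indpt2)
    fix c assume "lincomb c (e ` A) = \<zero>\<^bsub>V\<^esub>"
    then have "h (\<Sum>i\<in>A. Poly_Mapping.single i (c (e i))) = h 0"
      using lincomb[of A c] zero by simp
    moreover have "(\<Sum>i\<in>A. Poly_Mapping.single i (c (e i))) \<in> ?W"
      using keys_sum[of "\<lambda>i. Poly_Mapping.single i (c (e i))" A] by (auto split: if_splits)
    ultimately have sum0: "(\<Sum>i\<in>A. Poly_Mapping.single i (c (e i))) = 0"
      using inj by (auto dest: inj_onD)
    have "c (e i) = 0" if "i \<in> A" for i
      using arg_cong[OF sum0, of "\<lambda>x. Poly_Mapping.lookup x i"] that finA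
      by (simp add: lookup_sum lookup_single when_def)
    then show "\<forall>v\<in>e ` A. c v = \<zero>\<^bsub>class_ring\<^esub>" by simp
  qed (use finA e_car in auto)
  moreover have "span (e ` A) = carrier V"
  proof
    show "span (e ` A) \<subseteq> carrier V" using e_car by (rule span_is_subset2)
    show "carrier V \<subseteq> span (e ` A)"
    proof
      fix v assume "v \<in> carrier V"
      then obtain x where x: "Poly_Mapping.keys x \<subseteq> A" "v = h x" unfolding car by blast
      \<comment> \<open>In \<open>lincomb\<close> coefficients are indexed by vectors, so the
        coordinate of \<open>x\<close> is looked up through the inverse of \<open>e\<close>.\<close>
      define c where "c = (\<lambda>v. Poly_Mapping.lookup x (the_inv_into A e v))"
      have "x = (\<Sum>i\<in>A. Poly_Mapping.single i (c (e i)))"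
        using x finA by (intro poly_mapping_eqI)
          (auto simp: lookup_sum lookup_single when_def c_def the_inv_into_f_f[OF inj_e] in_keys_iff)
      then have "v = lincomb c (e ` A)" using lincomb[of A c] x by simp
      then show "v \<in> span (e ` A)" unfolding span_def using finA by auto
    qed
  qed
  ultimately have "dim = card (e ` A)"
    using finA e_car by (intro dim_basis) (auto simp: basis_def)
  then show ?thesis by (simp add: card_image inj_e)
qed

section \<open>The linearization of an action of the free monoid\<close>

definition act_word :: "('x \<Rightarrow> nat \<Rightarrow> nat) \<Rightarrow> 'x word \<Rightarrow> nat \<Rightarrow> nat"
  where "act_word act w = fold act (letters w)"

lemma act_word_0 [simp]: "act_word act 0 i = i"
  by (simp add: act_word_def zero_word_def)

lemma act_word_plus: "act_word act (v + w) i = act_word act w (act_word act v i)"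
  by (simp add: act_word_def plus_word_def)

definition word_map :: "('x \<Rightarrow> nat \<Rightarrow> nat) \<Rightarrow> 'x word \<Rightarrow> (nat \<Rightarrow>\<^sub>0 'a::field) \<Rightarrow> (nat \<Rightarrow>\<^sub>0 'a)"
  where "word_map act w = lin_ext (\<lambda>i. Poly_Mapping.single (act_word act w i) 1)"

lemma word_map_plus: "word_map act (v + w) x = word_map act w (word_map act v x)"
  by (induction x rule: poly_mapping_additive_induct)
    (simp_all add: word_map_def lin_ext_add mult_single act_word_plus)

lemma word_map_0 [simp]: "word_map act 0 x = x"
  by (induction x rule: poly_mapping_additive_induct)
    (simp_all add: word_map_def lin_ext_add mult_single)

definition action_module ::
    "('x \<Rightarrow> nat \<Rightarrow> nat) \<Rightarrow> (('x, 'a::field) free_alg, nat \<Rightarrow>\<^sub>0 'a) module"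
  where "action_module act =
    \<lparr>carrier = UNIV, mult = (*), one = 1, zero = 0, add = (+),
     smult = (\<lambda>f x. lin_ext (\<lambda>w. word_map act w x) f)\<rparr>"

lemma action_module_simps [simp]:
  "carrier (action_module act) = UNIV" "zero (action_module act) = 0"
  "add (action_module act) = (+)"
  by (simp_all add: action_module_def)

lemma action_smult: "f \<odot>\<^bsub>action_module act\<^esub> x = lin_ext (\<lambda>w. word_map act w x) f"
  by (simp add: action_module_def)

lemma action_smult_add_left:
  "(f + g) \<odot>\<^bsub>action_module act\<^esub> x = f \<odot>\<^bsub>action_module act\<^esub> x + g \<odot>\<^bsub>action_module act\<^esub> x"
  by (simp add: action_smult lin_ext_add)

lemma action_smult_add_right:
  "f \<odot>\<^bsub>action_module act\<^esub> (x + y) = f \<odot>\<^bsub>action_module act\<^esub> x + f \<odot>\<^bsub>action_module act\<^esub> y"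
  by (simp add: action_smult word_map_def lin_ext_add lin_ext_add_fun)

lemma action_smult_scalar [simp]:
  "Poly_Mapping.single 0 c \<odot>\<^bsub>action_module act\<^esub> x = Poly_Mapping.single 0 c * x"
  by (simp add: action_smult)

lemma action_smult_single_single:
  "Poly_Mapping.single w c \<odot>\<^bsub>action_module act\<^esub> Poly_Mapping.single i d =
    Poly_Mapping.single (act_word act w i) (c * d)"
  by (simp add: action_smult word_map_def mult_single)

text \<open>Both sides are additive in \<open>f\<close> and in \<open>g\<close>, which reduces the
  claim to two monomials. There it is \<open>word_map_plus\<close> together with the commutativity
  of the field.\<close>

lemma action_smult_assoc:
  "(f * g) \<odot>\<^bsub>action_module act\<^esub> x = g \<odot>\<^bsub>action_module act\<^esub> (f \<odot>\<^bsub>action_module act\<^esub> x)"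
proof (induction f rule: poly_mapping_additive_induct)
  case zero
  show ?case by (simp add: action_smult word_map_def lin_ext_def)
next
  case (single_add v c f)
  have "(Poly_Mapping.single v c * g) \<odot>\<^bsub>action_module act\<^esub> x =
      g \<odot>\<^bsub>action_module act\<^esub> (Poly_Mapping.single v c \<odot>\<^bsub>action_module act\<^esub> x)"
  proof (induction g rule: poly_mapping_additive_induct)
    case zero
    show ?case by (simp add: action_smult)
  next
    case (single_add w d g)
    have "(Poly_Mapping.single v c * Poly_Mapping.single w d) \<odot>\<^bsub>action_module act\<^esub> x =
      Poly_Mapping.single w d \<odot>\<^bsub>action_module act\<^esub> (Poly_Mapping.single v c \<odot>\<^bsub>action_module act\<^esub> x)"
      by (simp add: mult_single action_smult word_map_plus)
        (simp add: word_map_def lin_ext_scale mult.assoc[symmetric] mult_single mult.commute)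
    with single_add show ?case
      by (simp add: distrib_left action_smult_add_left)
  qed
  with single_add show ?case
    by (simp add: distrib_right action_smult_add_left action_smult_add_right)
qed

lemma action_smult_one: "1 \<odot>\<^bsub>action_module act\<^esub> x = x"
  using action_smult_scalar[where c = 1] by simp

lemma right_module_action: "right_module class_ring (action_module act)"
proof -
  have "abelian_group (action_module act)"
    by (rule abelian_groupI) (auto simp: add.assoc intro: add.commute add.left_inverse)
  then show ?thesis
    unfolding right_module_def right_module_axioms_def
    by (simp add: class_ring.ring_axioms action_smult_add_left action_smult_add_right
        action_smult_assoc action_smult_one)
qed

lemma keys_action_smult:
  "Poly_Mapping.keys (f \<odot>\<^bsub>action_module act\<^esub> x) \<subseteq>
    (\<Union>w\<in>Poly_Mapping.keys f. act_word act w ` Poly_Mapping.keys x)"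
proof -
  have "Poly_Mapping.keys (word_map act w x) \<subseteq> act_word act w ` Poly_Mapping.keys x" for w
    unfolding word_map_def by (rule order_trans[OF keys_lin_ext]) auto
  then show ?thesis
    unfolding action_smult by (intro order_trans[OF keys_lin_ext] UN_mono order_refl)
qed

text \<open>Different words may lead to the same point and their contributions may cancel, yet the
  orbit is a full coordinate subspace: for each reached point a single word already yields all
  multiples of its basis vector.\<close>

lemma orbit_action_single:
  "orbit (action_module act) (Poly_Mapping.single i (1::'a::field)) {f. Poly_Mapping.keys f \<subseteq> L} =
    {y. Poly_Mapping.keys y \<subseteq> (\<lambda>w. act_word act w i) ` L}"
  (is "?O = _")
proof
  show "?O \<subseteq> {y. Poly_Mapping.keys y \<subseteq> (\<lambda>w. act_word act w i) ` L}"
  proof -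
    have "Poly_Mapping.keys (f \<odot>\<^bsub>action_module act\<^esub> Poly_Mapping.single i (1::'a)) \<subseteq>
        (\<lambda>w. act_word act w i) ` L" if "Poly_Mapping.keys f \<subseteq> L" for f
      using that by (intro order_trans[OF keys_action_smult]) auto
    then show ?thesis by (auto simp: orbit_def)
  qed
  have "Poly_Mapping.keys y \<subseteq> (\<lambda>w. act_word act w i) ` L \<Longrightarrow> y \<in> ?O" for y
  proof (induction y rule: poly_mapping_additive_induct)
    case zero
    show ?case by (auto simp: orbit_def action_smult intro!: image_eqI[of _ _ 0])
  next
    case (single_add j c y)
    have keys: "Poly_Mapping.keys (Poly_Mapping.single j c + y) =
      Poly_Mapping.keys (Poly_Mapping.single j c) \<union> Poly_Mapping.keys y"
      using single_add(1) by (rule keys_single_add)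
    then obtain f where f: "Poly_Mapping.keys f \<subseteq> L"
      "y = f \<odot>\<^bsub>action_module act\<^esub> Poly_Mapping.single i 1"
      using single_add by (auto simp: orbit_def)
    show ?case
    proof (cases "c = 0")
      case True
      then show ?thesis using f by (auto simp: orbit_def)
    next
      case False
      then obtain w where w: "w \<in> L" "j = act_word act w i" using single_add keys by auto
      let ?g = "Poly_Mapping.single w c + f"
      have "Poly_Mapping.keys ?g \<subseteq> L" using f w by (intro order_trans[OF keys_add]) auto
      moreover have "Poly_Mapping.single j c + y =
          ?g \<odot>\<^bsub>action_module act\<^esub> Poly_Mapping.single i 1"
        using f w by (simp add: action_smult_add_left action_smult_single_single)
      ultimately show ?thesis by (auto simp: orbit_def)
    qed
  qed
  then show "{y. Poly_Mapping.keys y \<subseteq> (\<lambda>w. act_word act w i) ` L} \<subseteq> ?O" by auto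
qed

section \<open>Growth as the number of reachable points\<close>

definition reach :: "('x \<Rightarrow> nat \<Rightarrow> nat) \<Rightarrow> nat \<Rightarrow> nat \<Rightarrow> nat set"
  where "reach act i n = (\<lambda>w. act_word act w i) ` {w. length (letters w) \<le> n}"

lemma reach_iff: "j \<in> reach act i n \<longleftrightarrow> (\<exists>xs. length xs \<le> n \<and> j = fold act xs i)"
  by (auto simp: reach_def act_word_def image_iff intro: exI[of _ "Word _"])

lemma finite_reach: "finite (reach (act :: 'x::finite \<Rightarrow> _) i n)"
proof -
  have "reach act i n = (\<lambda>xs. fold act xs i) ` {xs. set xs \<subseteq> UNIV \<and> length xs \<le> n}"
    by (auto simp: reach_iff)
  then show ?thesis using finite_lists_length_le[of "UNIV :: 'x set" n] by simp
qed

lemma orbit_deg_le: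
  "orbit (action_module act) (Poly_Mapping.single i (1::'a::field)) (deg_le n) =
    {y. Poly_Mapping.keys y \<subseteq> reach act i n}"
  unfolding deg_le_eq orbit_action_single reach_def ..

lemma orbit_UNIV:
  "orbit (action_module act) (Poly_Mapping.single i (1::'a::field)) UNIV =
    {y. Poly_Mapping.keys y \<subseteq> (\<Union>n. reach act i n)}"
proof -
  have "range (\<lambda>w. act_word act w i) = (\<Union>n. reach act i n)"
    by (auto simp: reach_def)
  then show ?thesis using orbit_action_single[of act i UNIV, where 'a = 'a] by simp
qed

lemma growth_action_module:
  fixes act :: "'x::finite \<Rightarrow> nat \<Rightarrow> nat"
  shows "growth (action_module act) (Poly_Mapping.single i (1::'a::field)) n = card (reach act i n)"
  unfolding growth_def orbit_deg_le
  by (rule dim_coordinate_space[where h = id]) (auto simp: restrict_scalars_def finite_reach)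

lemma growth_cyclic_submodule: "growth (cyclic_submodule M a) a n = growth M a n"
  by (simp add: growth_def cyclic_submodule_def restrict_scalars_def orbit_def)

lemma keys_subset_iff: "Poly_Mapping.keys x \<subseteq> E \<longleftrightarrow> (\<forall>k. k \<notin> E \<longrightarrow> Poly_Mapping.lookup x k = 0)"
  by (auto simp: in_keys_iff)

section \<open>The quotient by the span of a stable set of points\<close>

context
  fixes act :: "'x::finite \<Rightarrow> nat \<Rightarrow> nat" and E :: "nat set"
    and M :: "(('x, 'a::field) free_alg, nat \<Rightarrow>\<^sub>0 'a) module" and N :: "(nat \<Rightarrow>\<^sub>0 'a) set"
  assumes closed: "\<And>x i. i \<in> E \<Longrightarrow> act x i \<in> E"
    and M: "M = action_module act"
    and N: "N = {y. Poly_Mapping.keys y \<subseteq> E}"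
begin

lemma add_M: "x \<oplus>\<^bsub>M\<^esub> y = x + y"
  by (simp add: M)

lemma coset_eq: "N +>\<^bsub>M\<^esub> x = {z. Poly_Mapping.keys (z - x) \<subseteq> E}"
proof -
  have "z = (z - x) + x" for z :: "nat \<Rightarrow>\<^sub>0 'a" by simp
  then show ?thesis unfolding a_r_coset_def' M N by force
qed

lemma coset_eq_iff: "N +>\<^bsub>M\<^esub> x = N +>\<^bsub>M\<^esub> y \<longleftrightarrow> Poly_Mapping.keys (x - y) \<subseteq> E"
proof
  assume "N +>\<^bsub>M\<^esub> x = N +>\<^bsub>M\<^esub> y"
  moreover have "x \<in> N +>\<^bsub>M\<^esub> x" by (simp add: coset_eq)
  ultimately show "Poly_Mapping.keys (x - y) \<subseteq> E" by (simp add: coset_eq)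
next
  assume "Poly_Mapping.keys (x - y) \<subseteq> E"
  then show "N +>\<^bsub>M\<^esub> x = N +>\<^bsub>M\<^esub> y"
    by (auto simp: coset_eq keys_subset_iff lookup_minus)
qed

lemma coset_add: "set_add M (N +>\<^bsub>M\<^esub> x) (N +>\<^bsub>M\<^esub> y) = N +>\<^bsub>M\<^esub> (x + y)"
proof
  show "set_add M (N +>\<^bsub>M\<^esub> x) (N +>\<^bsub>M\<^esub> y) \<subseteq> N +>\<^bsub>M\<^esub> (x + y)"
    by (auto simp: set_add_def' coset_eq keys_subset_iff lookup_minus lookup_add add_M)
  show "N +>\<^bsub>M\<^esub> (x + y) \<subseteq> set_add M (N +>\<^bsub>M\<^esub> x) (N +>\<^bsub>M\<^esub> y)"
  proof
    fix z assume "z \<in> N +>\<^bsub>M\<^esub> (x + y)"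
    then have "z - x \<in> N +>\<^bsub>M\<^esub> y" "x \<in> N +>\<^bsub>M\<^esub> x"
      by (simp_all add: coset_eq diff_diff_add)
    moreover have "z = x \<oplus>\<^bsub>M\<^esub> (z - x)" by (simp add: add_M)
    ultimately show "z \<in> set_add M (N +>\<^bsub>M\<^esub> x) (N +>\<^bsub>M\<^esub> y)"
      unfolding set_add_def' by blast
  qed
qed

lemma closed_act_word: "i \<in> E \<Longrightarrow> act_word act w i \<in> E"
proof -
  have "fold act xs i \<in> E" if "i \<in> E" for xs
    using that by (induction xs arbitrary: i) (auto simp: closed)
  then show "i \<in> E \<Longrightarrow> act_word act w i \<in> E" by (simp add: act_word_def)
qed

text \<open>The action on the quotient is a union over all representatives. Stability of
  \<open>E\<close> makes \<open>f\<close> map \<open>N\<close> into itself, so all sets in that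
  union coincide.\<close>

lemma coset_smult:
  "f \<odot>\<^bsub>quotient_module M N\<^esub> (N +>\<^bsub>M\<^esub> y) = N +>\<^bsub>M\<^esub> (f \<odot>\<^bsub>M\<^esub> y)"
proof -
  have "N +>\<^bsub>M\<^esub> (f \<odot>\<^bsub>M\<^esub> x) = N +>\<^bsub>M\<^esub> (f \<odot>\<^bsub>M\<^esub> y)" if "x \<in> N +>\<^bsub>M\<^esub> y" for x
  proof -
    have "f \<odot>\<^bsub>M\<^esub> x = f \<odot>\<^bsub>M\<^esub> (x - y) + f \<odot>\<^bsub>M\<^esub> y"
      unfolding M action_smult_add_right[symmetric] diff_add_cancel ..
    then have diff: "f \<odot>\<^bsub>M\<^esub> x - f \<odot>\<^bsub>M\<^esub> y = f \<odot>\<^bsub>M\<^esub> (x - y)" by simp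
    have "Poly_Mapping.keys (x - y) \<subseteq> E" using that unfolding coset_eq by simp
    then have "Poly_Mapping.keys (f \<odot>\<^bsub>M\<^esub> (x - y)) \<subseteq> E"
      unfolding M by (intro order_trans[OF keys_action_smult] UN_least image_subsetI closed_act_word)
        (erule subsetD)
    then show ?thesis unfolding coset_eq_iff diff .
  qed
  moreover have "y \<in> N +>\<^bsub>M\<^esub> y" by (simp add: coset_eq)
  ultimately have "(\<Union>x\<in>N +>\<^bsub>M\<^esub> y. N +>\<^bsub>M\<^esub> (f \<odot>\<^bsub>M\<^esub> x)) = N +>\<^bsub>M\<^esub> (f \<odot>\<^bsub>M\<^esub> y)"
    by (intro UN_constant_eq ballI)
  then show ?thesis
    by (simp add: quotient_module_def)
qed

text \<open>Deleting the coordinates in \<open>E\<close> gives each coset of the orbit a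
  representative supported in \<open>reach act i n - E\<close>, and there is only one such
  representative. Hence the coset map identifies the orbit with a coordinate space.\<close>

lemma growth_quotient_module:
  "growth (quotient_module M N) (N +>\<^bsub>M\<^esub> Poly_Mapping.single i 1) n = card (reach act i n - E)"
proof -
  let ?R = "reach act i n" and ?h = "\<lambda>y. N +>\<^bsub>M\<^esub> y"
  have orbit: "orbit (quotient_module M N) (?h (Poly_Mapping.single i 1)) (deg_le n) =
      ?h ` {y. Poly_Mapping.keys y \<subseteq> ?R}"
    unfolding orbit_deg_le[symmetric] by (simp add: orbit_def coset_smult image_image flip: M)
  have "bij_betw ?h {y. Poly_Mapping.keys y \<subseteq> ?R - E} (?h ` {y. Poly_Mapping.keys y \<subseteq> ?R})"
    unfolding bij_betw_def
  proof
    show "inj_on ?h {y. Poly_Mapping.keys y \<subseteq> ?R - E}"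
    proof (rule inj_onI)
      fix x y :: "nat \<Rightarrow>\<^sub>0 'a"
      assume "x \<in> {y. Poly_Mapping.keys y \<subseteq> ?R - E}" "y \<in> {y. Poly_Mapping.keys y \<subseteq> ?R - E}"
        and "?h x = ?h y"
      then have "Poly_Mapping.lookup x k = Poly_Mapping.lookup y k" for k
        by (cases "k \<in> E") (auto simp: coset_eq_iff keys_subset_iff lookup_minus)
      then show "x = y" by (rule poly_mapping_eqI)
    qed
    have "?h y \<in> ?h ` {y. Poly_Mapping.keys y \<subseteq> ?R - E}" if "Poly_Mapping.keys y \<subseteq> ?R" for y
    proof
      let ?y = "Poly_Mapping.mapp (\<lambda>k c. if k \<in> E then 0 else c) y"
      show "?h y = ?h ?y"
        by (auto simp: coset_eq_iff keys_subset_iff lookup_minus lookup_mapp when_def in_keys_iff)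
      show "?y \<in> {y. Poly_Mapping.keys y \<subseteq> ?R - E}"
        using that by (auto simp: keys_subset_iff lookup_mapp when_def)
    qed
    then show "?h ` {y. Poly_Mapping.keys y \<subseteq> ?R - E} = ?h ` {y. Poly_Mapping.keys y \<subseteq> ?R}"
      by auto
  qed
  moreover have "N = ?h 0" unfolding coset_eq by (simp add: N)
  moreover have "Poly_Mapping.single 0 c \<odot>\<^bsub>quotient_module M N\<^esub> ?h x =
      ?h (Poly_Mapping.single 0 c * x)" for c x
    unfolding coset_smult by (simp add: M)
  moreover have "add (quotient_module M N) (?h x) (?h y) = ?h (x + y)" for x y
    by (simp add: quotient_module_def coset_add)
  moreover have "zero (quotient_module M N) = N"
    by (simp add: quotient_module_def)
  ultimately show ?thesis
    unfolding growth_def orbit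
    by (intro dim_coordinate_space[where h = ?h]) (simp_all add: restrict_scalars_def finite_reach)
qed

end

section \<open>Words acting injectively under a unit-speed constraint\<close>

text \<open>
  The naturals are cut into blocks, one for each word length \<open>m\<close>, and the tree of words of length
  at most \<open>m\<close> is laid out in the \<open>m\<close>-th block. Reading a word $w$ as a number
  $c(w) = \sum_t d_t r^t$ in base $r$, it sits at \<open>block_root r m + length w - (m + 1) * c(w)\<close>. The
  residue modulo \<open>m + 1\<close> reveals the length of $w$, so that the effect of the next letter depends on
  the position only. The truncated subtraction in \<open>jump\<close> is exact along these words.
\<close>

primrec block_start :: "nat \<Rightarrow> nat \<Rightarrow> nat" where
  "block_start r 0 = 0"
| "block_start r (Suc m) = Suc m * (block_start r m + (r ^ m - 1)) + Suc m"

text \<open>The root has residue 0 modulo \<open>Suc m\<close>. For positive \<open>r\<close>, the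
  largest $c(w)$ for words of length at most \<open>m\<close> is \<open>r ^ m - 1\<close>, so their
  positions are at least \<open>Suc m * block_start r m\<close> and stay in the block. The block
  ends at \<open>block_root r m + m\<close>, the position of the word of \<open>m\<close>
  zeros.\<close>

definition block_root :: "nat \<Rightarrow> nat \<Rightarrow> nat"
  where "block_root r m = Suc m * (block_start r m + (r ^ m - 1))"

definition block :: "nat \<Rightarrow> nat \<Rightarrow> nat"
  where "block r i = (LEAST m. i < block_start r (Suc m))"

text \<open>Appending the digit \<open>d\<close> to a word of length $t$ increases the length by 1
  and $c(w)$ by $d r^t$; the residue of \<open>i\<close> recovers $t$. Used at all positions, also
  off the trees, the formula never advances by more than one.\<close>

definition jump :: "nat \<Rightarrow> nat \<Rightarrow> nat \<Rightarrow> nat"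
  where "jump r d i = Suc i - Suc (block r i) * d * r ^ (i mod Suc (block r i))"

lemma jump_0 [simp]: "jump r 0 i = Suc i"
  by (simp add: jump_def)

lemma jump_le: "jump r d i \<le> Suc i"
  by (simp add: jump_def)

lemma mono_block_start: "mono (block_start r)"
  by (rule mono_iff_le_Suc[THEN iffD2]) (auto simp: algebra_simps)

lemma block_eq:
  assumes "block_start r m \<le> i" "i < block_start r (Suc m)"
  shows "block r i = m"
  unfolding block_def
proof (rule Least_equality)
  fix k assume k: "i < block_start r (Suc k)"
  show "m \<le> k"
  proof (rule ccontr)
    assume "\<not> m \<le> k"
    then have "block_start r (Suc k) \<le> block_start r m"
      using monoD[OF mono_block_start, of "Suc k" m r] by simp
    with k assms(1) show False by simp
  qed
qed fact

text \<open>The last letter read is the most significant digit of \<open>c\<close>. Induction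
  removes it, and the position \<open>p\<close> of the remaining prefix determines both the block
  \<open>m\<close> and the length \<open>t\<close>, so that \<open>jump\<close> subtracts the right
  multiple.\<close>

lemma fold_jump_block_root:
  fixes digit :: "'x \<Rightarrow> nat"
  assumes digit: "range digit = {..<r}" and "t \<le> m" "c < r ^ t"
  shows "\<exists>xs. length xs = t \<and>
    fold (\<lambda>x. jump r (digit x)) xs (block_root r m) = block_root r m + t - Suc m * c"
  using assms(2,3)
proof (induction t arbitrary: c)
  case 0
  then show ?case by simp
next
  case (Suc t)
  have r: "r > 0" using Suc.prems by (cases r) auto
  define c0 where "c0 = c mod r ^ t"
  define d where "d = c div r ^ t"
  have c: "c = c0 + d * r ^ t" by (metis add.commute div_mult_mod_eq c0_def d_def)
  have c0: "c0 < r ^ t" using r by (simp add: c0_def)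
  have "d < r" unfolding d_def using Suc.prems(2) by (simp add: less_mult_imp_div_less mult.commute)
  then obtain x where x: "digit x = d" using digit by (metis imageE lessThan_iff)
  obtain xs where xs: "length xs = t"
    "fold (\<lambda>x. jump r (digit x)) xs (block_root r m) = block_root r m + t - Suc m * c0"
    using Suc.IH[of c0] Suc.prems c0 by auto
  define p where "p = block_root r m + t - Suc m * c0"
  \<comment> \<open>The next estimates show that the subtraction in \<open>p\<close> is exact and
    that \<open>p\<close> does not fall below the block.\<close>
  have "r ^ t \<le> r ^ m" using r Suc.prems by (intro power_increasing) auto
  then have "c0 \<le> r ^ m - 1" using c0 by linarith
  then have "Suc m * (block_start r m + c0) \<le> block_root r m"
    unfolding block_root_def by (intro mult_le_mono) auto
  then have le: "Suc m * block_start r m + Suc m * c0 \<le> block_root r m"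
    by (simp only: distrib_left)
  have lower: "block_start r m \<le> p"
    using le unfolding p_def by simp
  have upper: "p < block_start r (Suc m)"
    using Suc.prems unfolding p_def by (simp add: block_root_def)
  have block: "block r p = m" using lower upper by (rule block_eq)
  \<comment> \<open>The quotient of \<open>p\<close> by \<open>Suc m\<close>, exhibited in order to
    read off the remainder \<open>t\<close>.\<close>
  define q where "q = block_start r m + (r ^ m - 1) - c0"
  have "p = Suc m * q + t"
    using le \<open>c0 \<le> r ^ m - 1\<close> unfolding p_def q_def block_root_def
    by (simp only: diff_mult_distrib2)
  then have "p mod Suc m = t"
    using Suc.prems
    by (metis Suc_le_eq le_SucI mod_less mod_mult_self4 less_Suc_eq_le order.strict_implies_order)
  then have "jump r d p = Suc p - Suc m * d * r ^ t"
    by (simp add: jump_def block)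
  \<comment> \<open>By \<open>le\<close>, the successor can be moved inside the first difference.
    Nested truncated differences then merge unconditionally, so no bound on \<open>c\<close> itself
    is needed here.\<close>
  also have "\<dots> = block_root r m + Suc t - Suc m * c"
    using le unfolding p_def c by (simp add: algebra_simps)
  finally show ?case
    using xs x by (intro exI[of _ "xs @ [x]"]) (simp add: p_def)
qed

section \<open>The construction\<close>

text \<open>The even number \<open>2 * i\<close> stands for $f_i$ and the odd number \<open>2 * i + 1\<close> for $e_i$.\<close>

definition ext_act :: "('x \<Rightarrow> nat) \<Rightarrow> nat \<Rightarrow> (nat \<Rightarrow> nat) \<Rightarrow> 'x \<Rightarrow> nat \<Rightarrow> nat" where
  "ext_act digit r \<mu> x k =
    (if odd k then 2 * jump r (digit x) (k div 2) + 1
     else if digit x = 0 then k + 2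
     else 2 * block_root r (\<mu> (k div 2)) + 1)"

lemma ext_act_odd: "ext_act digit r \<mu> x (2 * i + 1) = 2 * jump r (digit x) i + 1"
  by (simp add: ext_act_def)

lemma ext_act_even:
  "ext_act digit r \<mu> x (2 * i) =
    (if digit x = 0 then 2 * Suc i else 2 * block_root r (\<mu> i) + 1)"
  by (simp add: ext_act_def)

lemma fold_ext_act_odd:
  "fold (ext_act digit r \<mu>) xs (2 * i + 1) = 2 * fold (\<lambda>x. jump r (digit x)) xs i + 1"
  by (induction xs arbitrary: i) (simp_all only: fold.simps ext_act_odd id_apply comp_apply)

lemma fold_jump_le: "fold (\<lambda>x. jump r (digit x)) xs i \<le> i + length xs"
proof (induction xs arbitrary: i)
  case (Cons x xs)
  show ?case
    using order_trans[OF Cons.IH[of "jump r (digit x) i"]] jump_le[of r "digit x" i] by simp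
qed simp

lemma fold_jump_replicate:
  "digit x = 0 \<Longrightarrow> fold (\<lambda>x. jump r (digit x)) (replicate j x) i = i + j"
  by (induction j arbitrary: i) simp_all

lemma fold_ext_act_replicate:
  "digit x = 0 \<Longrightarrow> fold (ext_act digit r \<mu>) (replicate j x) (2 * i) = 2 * (i + j)"
  proof (induction j arbitrary: i)
  case (Suc j)
  then show ?case using Suc.IH[of "Suc i"] by (simp add: ext_act_even)
qed simp

text \<open>A word of zero letters only shifts. Otherwise its first nonzero letter enters the odd
  numbers, which are never left again.\<close>

lemma fold_ext_act_even:
  "odd (fold (ext_act digit r \<mu>) xs (2 * i)) \<or>
   fold (ext_act digit r \<mu>) xs (2 * i) = 2 * (i + length xs)"
proof (induction xs arbitrary: i)
  case (Cons x xs)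
  show ?case
  proof (cases "digit x = 0")
    case True
    \<comment> \<open>The term \<open>2 * Suc i\<close> must keep this shape to match the induction
      hypothesis.\<close>
    then show ?thesis using Cons.IH[of "Suc i"] by (simp add: ext_act_even del: mult_Suc_right)
  next
    case False
    then show ?thesis
      using fold_ext_act_odd[of digit r \<mu> xs "block_root r (\<mu> i)"] by (simp add: ext_act_even)
  qed
qed simp


section \<open>Points reachable from $f_0$ and $e_0$\<close>

context
  fixes digit :: "'x::finite \<Rightarrow> nat" and r :: nat and \<mu> :: "nat \<Rightarrow> nat"
  assumes r: "r > 1" and digit: "range digit = {..<r}" and \<mu>: "\<mu> 0 = 0"
begin

lemma obtain_digits:
  obtains x0 x1 where "digit x0 = 0" "digit x1 = 1"
proof -
  have "0 \<in> range digit" "1 \<in> range digit" using r digit by auto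
  then show thesis using that by (metis imageE)
qed

text \<open>No letter advances along the $e_i$ by more than one, and the letter with digit 0 attains
  this speed.\<close>

lemma reach_ext_act_1: "reach (ext_act digit r \<mu>) 1 n = (\<lambda>j. 2 * j + 1) ` {..n}"
proof
  show "reach (ext_act digit r \<mu>) 1 n \<subseteq> (\<lambda>j. 2 * j + 1) ` {..n}"
  proof
    fix k assume "k \<in> reach (ext_act digit r \<mu>) 1 n"
    then obtain xs where "length xs \<le> n" "k = fold (ext_act digit r \<mu>) xs 1"
      unfolding reach_iff by blast
    then show "k \<in> (\<lambda>j. 2 * j + 1) ` {..n}"
      using fold_ext_act_odd[of digit r \<mu> xs 0] fold_jump_le[of r digit xs 0] by auto
  qed
  obtain x0 where "digit x0 = 0" using obtain_digits by blast
  then have "2 * j + 1 \<in> reach (ext_act digit r \<mu>) 1 n" if "j \<le> n" for j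
    using fold_ext_act_odd[of digit r \<mu> "replicate j x0" 0]
      fold_jump_replicate[of digit x0 r j 0] that
    by (auto simp: reach_iff simp del: fold_replicate intro!: exI[of _ "replicate j x0"])
  then show "(\<lambda>j. 2 * j + 1) ` {..n} \<subseteq> reach (ext_act digit r \<mu>) 1 n" by auto
qed

lemma reach_ext_act_0_even:
  "reach (ext_act digit r \<mu>) 0 n - {k. odd k} = (\<lambda>j. 2 * j) ` {..n}"
proof
  show "reach (ext_act digit r \<mu>) 0 n - {k. odd k} \<subseteq> (\<lambda>j. 2 * j) ` {..n}"
  proof
    fix k assume "k \<in> reach (ext_act digit r \<mu>) 0 n - {k. odd k}"
    then obtain xs where "length xs \<le> n" "k = fold (ext_act digit r \<mu>) xs 0" "even k"
      by (auto simp: reach_iff)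
    then show "k \<in> (\<lambda>j. 2 * j) ` {..n}"
      using fold_ext_act_even[of digit r \<mu> xs 0] by auto
  qed
  obtain x0 where "digit x0 = 0" using obtain_digits by blast
  then have "2 * j \<in> reach (ext_act digit r \<mu>) 0 n" if "j \<le> n" for j
    using fold_ext_act_replicate[of digit x0 r \<mu> j 0] that
    by (auto simp: reach_iff intro!: exI[of _ "replicate j x0"])
  then show "(\<lambda>j. 2 * j) ` {..n} \<subseteq> reach (ext_act digit r \<mu>) 0 n - {k. odd k}" by auto
qed

lemma UN_reach_ext_act_1: "(\<Union>n. reach (ext_act digit r \<mu>) 1 n) = {k. odd k}"
  unfolding reach_ext_act_1 by (auto simp: image_iff elim!: oddE)

text \<open>This makes $f_0$ a generator of the whole module. Since \<open>\<mu> 0 = 0\<close> and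
  \<open>block_root r 0 = 0\<close>, a nonzero letter takes $f_0$ to $e_0$, from where shifts reach
  every $e_j$.\<close>

lemma UN_reach_ext_act_0: "(\<Union>n. reach (ext_act digit r \<mu>) 0 n) = UNIV"
proof -
  obtain x0 x1 where x: "digit x0 = 0" "digit x1 = 1" using obtain_digits by blast
  have "2 * j + 1 \<in> reach (ext_act digit r \<mu>) 0 (Suc j)" for j
    using fold_ext_act_odd[of digit r \<mu> "replicate j x0" 0]
      fold_jump_replicate[of digit x0 r j 0] ext_act_even[of digit r \<mu> x1 0] x \<mu>
    by (auto simp: reach_iff block_root_def
        simp del: fold_replicate intro!: exI[of _ "x1 # replicate j x0"])
  moreover have "2 * j \<in> reach (ext_act digit r \<mu>) 0 j" for j
    using reach_ext_act_0_even[of j] by auto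
  ultimately show ?thesis
    by (metis UN_I UNIV_I UNIV_eq_I evenE oddE)
qed

text \<open>Going from $f_0$ to $f_i$ takes \<open>i\<close> shifts, and one more letter leads to
  the root of block \<open>\<mu> i\<close>. From there the words of length \<open>t\<close> reach
  the $r^t$ distinct points \<open>p c\<close>.\<close>

lemma card_reach_ext_act_0:
  assumes "i + 1 + t \<le> n" "t \<le> \<mu> i"
  shows "r ^ t \<le> card (reach (ext_act digit r \<mu>) 0 n)"
proof -
  define p where "p c = 2 * (block_root r (\<mu> i) + t - Suc (\<mu> i) * c) + 1" for c
  obtain x0 x1 where x: "digit x0 = 0" "digit x1 = 1" using obtain_digits by blast
  have "p c \<in> reach (ext_act digit r \<mu>) 0 n" if c: "c < r ^ t" for c
  proof -
    obtain xs where xs: "length xs = t" "fold (\<lambda>x. jump r (digit x)) xs (block_root r (\<mu> i)) =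
        block_root r (\<mu> i) + t - Suc (\<mu> i) * c"
      using fold_jump_block_root[OF digit assms(2) c] by blast
    have "fold (ext_act digit r \<mu>) (replicate i x0 @ x1 # xs) 0 = p c"
      using fold_ext_act_replicate[of digit x0 r \<mu> i 0] x
        fold_ext_act_odd[of digit r \<mu> xs "block_root r (\<mu> i)"] xs
      by (simp add: ext_act_even p_def)
    then show ?thesis
      using xs assms(1) unfolding reach_iff by (intro exI[of _ "replicate i x0 @ x1 # xs"]) auto
  qed
  then have sub: "p ` {..<r ^ t} \<subseteq> reach (ext_act digit r \<mu>) 0 n" by auto
  \<comment> \<open>Without truncation in the definition of \<open>p\<close>, the number
    \<open>c\<close> can be recovered from \<open>p c\<close>.\<close>
  have le: "Suc (\<mu> i) * c \<le> block_root r (\<mu> i)" if "c < r ^ t" for c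
  proof -
    have "r ^ t \<le> r ^ \<mu> i" using r assms(2) by (intro power_increasing) auto
    with that have "c \<le> block_start r (\<mu> i) + (r ^ \<mu> i - 1)" by linarith
    then show ?thesis unfolding block_root_def by (rule mult_le_mono2)
  qed
  have "inj_on p {..<r ^ t}"
  proof (rule inj_onI)
    fix c d assume "c \<in> {..<r ^ t}" "d \<in> {..<r ^ t}" "p c = p d"
    then have "Suc (\<mu> i) * c = Suc (\<mu> i) * d"
      using le[of c] le[of d] unfolding p_def by simp
    then show "c = d" by (metis mult_cancel1 nat.distinct(1))
  qed
  then show ?thesis
    using card_mono[OF finite_reach sub] by (simp add: card_image)
qed

end

section \<open>Choice of the thresholds and proof of the theorem\<close>

lemma obtain_thresholds:
  fixes \<alpha> :: "nat \<Rightarrow> real"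
  assumes r: "r > (1::nat)" and \<alpha>: "\<alpha> \<longlonglongrightarrow> 0"
  obtains \<nu> :: "nat \<Rightarrow> nat" where "\<And>i. i < \<nu> (Suc i)"
    "\<And>i n. i > 0 \<Longrightarrow> \<nu> i \<le> n \<Longrightarrow> i + 1 \<le> n \<and> \<alpha> n * real r ^ n < real r ^ (n - i - 1)"
proof -
  have "\<exists>T. \<forall>n\<ge>T. \<alpha> n < 1 / real r ^ (i + 1)" for i
    using order_tendstoD(2)[OF \<alpha>, of "1 / real r ^ (i + 1)"] r
    by (simp add: eventually_sequentially)
  then obtain T where T: "\<And>i n. T i \<le> n \<Longrightarrow> \<alpha> n < 1 / real r ^ (i + 1)" by metis
  \<comment> \<open>For positive \<open>i\<close> the last summand contains \<open>T i\<close>. The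
    constant 2 gives \<open>2 * i \<le> \<nu> i\<close>, hence both
    \<open>i + 1 \<le> \<nu> i\<close> for positive \<open>i\<close> and
    \<open>i < \<nu> (Suc i)\<close>.\<close>
  define \<nu> where "\<nu> i = (\<Sum>j<i. T (Suc j) + 2)" for i
  have ge: "2 * i \<le> \<nu> i" for i
    by (induction i) (auto simp: \<nu>_def)
  have "i + 1 \<le> n \<and> \<alpha> n * real r ^ n < real r ^ (n - i - 1)" if "i > 0" "\<nu> i \<le> n" for i n
  proof
    show le: "i + 1 \<le> n" using ge[of i] that by simp
    have "T i \<le> n" using that by (cases i) (auto simp: \<nu>_def)
    then have "\<alpha> n * real r ^ n < 1 / real r ^ (i + 1) * real r ^ n"
      using r by (intro mult_strict_right_mono T) auto
    also have "\<dots> = real r ^ (n - (i + 1))"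
      using r le by (subst power_diff) auto
    finally show "\<alpha> n * real r ^ n < real r ^ (n - i - 1)" by simp
  qed
  moreover have "i < \<nu> (Suc i)" for i using ge[of "Suc i"] by simp
  ultimately show thesis using that by blast
qed

lemma linear_growthI:
  assumes "\<And>n. growth V a n = Suc n"
  shows "linear_growth V a"
  unfolding linear_growth_def assms
  by (intro exI[of _ 1] exI[of _ 2] conjI eventually_sequentiallyI[of 1]) auto

theorem proposition11:
  fixes \<alpha> :: "nat \<Rightarrow> real"
  assumes "CARD('x) > 1"
    and "\<And>n. \<alpha> n \<ge> 0"
    and "\<alpha> \<longlonglongrightarrow> 0"
  shows "\<exists>(M :: (('x::finite, 'a::field) free_alg, nat \<Rightarrow>\<^sub>0 'a) module) \<epsilon> b.
    right_module class_ring M \<and>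
    \<epsilon> \<in> carrier M \<and> carrier M = orbit M \<epsilon> UNIV \<and>
    b \<in> carrier M \<and>
    (let N = cyclic_submodule M b in
      linear_growth N b \<and>
      linear_growth (quotient_module M (carrier N)) (carrier N +>\<^bsub>M\<^esub> \<epsilon>)) \<and>
    (\<forall>\<^sub>F n in sequentially. real (growth M \<epsilon> n) > \<alpha> n * real CARD('x) ^ n)"
proof -
  define r where "r = CARD('x)"
  have r: "r > 1" using assms(1) by (simp add: r_def)
  obtain digit :: "'x \<Rightarrow> nat" where "bij_betw digit UNIV {..<r}"
    using ex_bij_betw_finite_nat[of "UNIV :: 'x set"] by (auto simp: r_def atLeast0LessThan)
  then have digit: "range digit = {..<r}" by (simp add: bij_betw_def)
  obtain \<nu> where \<nu>: "\<And>i. i < \<nu> (Suc i)"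
    "\<And>i n. i > 0 \<Longrightarrow> \<nu> i \<le> n \<Longrightarrow> i + 1 \<le> n \<and> \<alpha> n * real r ^ n < real r ^ (n - i - 1)"
    using obtain_thresholds[OF r assms(3)] by metis
  \<comment> \<open>The exit at $f_i$ serves those \<open>n\<close> with
    \<open>\<nu> i \<le> n < \<nu> (Suc i)\<close>; a depth of \<open>\<nu> (Suc i)\<close> leaves
    room for the remaining \<open>n - i - 1\<close> letters. The value at 0 is reserved for reaching
    $e_0$.\<close>
  define \<mu> where "\<mu> i = (if i = 0 then 0 else \<nu> (Suc i))" for i
  have \<mu>: "\<mu> 0 = 0" by (simp add: \<mu>_def)
  define act where "act = ext_act digit r \<mu>"
  note reach =
    reach_ext_act_1[where digit = digit and r = r and \<mu> = \<mu>, OF r digit \<mu>]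
    reach_ext_act_0_even[where digit = digit and r = r and \<mu> = \<mu>, OF r digit \<mu>]
    UN_reach_ext_act_1[where digit = digit and r = r and \<mu> = \<mu>, OF r digit \<mu>]
    UN_reach_ext_act_0[where digit = digit and r = r and \<mu> = \<mu>, OF r digit \<mu>]
    card_reach_ext_act_0[where digit = digit and r = r and \<mu> = \<mu>, OF r digit \<mu>]
  define M :: "(('x, 'a) free_alg, nat \<Rightarrow>\<^sub>0 'a) module" where "M = action_module act"
  define \<epsilon> :: "nat \<Rightarrow>\<^sub>0 'a" where "\<epsilon> = Poly_Mapping.single 0 1"
  define b :: "nat \<Rightarrow>\<^sub>0 'a" where "b = Poly_Mapping.single 1 1"
  have "linear_growth (cyclic_submodule M b) b"
    by (rule linear_growthI)
      (simp add: growth_cyclic_submodule M_def b_def growth_action_module act_def reach(1)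
        card_image inj_on_def del: One_nat_def)
  moreover have "linear_growth (quotient_module M (carrier (cyclic_submodule M b)))
      (carrier (cyclic_submodule M b) +>\<^bsub>M\<^esub> \<epsilon>)"
  proof (rule linear_growthI)
    fix n
    have N: "carrier (cyclic_submodule M b) = {y. Poly_Mapping.keys y \<subseteq> {k. odd k}}"
      by (simp add: cyclic_submodule_def M_def b_def orbit_UNIV act_def reach(3) del: One_nat_def)
    have closed: "act x k \<in> {k. odd k}" if "k \<in> {k. odd k}" for x k
      using that by (simp add: act_def ext_act_def)
    have "growth (quotient_module M (carrier (cyclic_submodule M b)))
        (carrier (cyclic_submodule M b) +>\<^bsub>M\<^esub> \<epsilon>) n = card (reach act 0 n - {k. odd k})"
      unfolding \<epsilon>_def by (rule growth_quotient_module[OF closed M_def N])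
    then show "growth (quotient_module M (carrier (cyclic_submodule M b)))
        (carrier (cyclic_submodule M b) +>\<^bsub>M\<^esub> \<epsilon>) n = Suc n"
      by (simp add: act_def reach(2) card_image inj_on_def)
  qed
  moreover have "\<alpha> n * real r ^ n < real (growth M \<epsilon> n)" if n: "\<nu> 1 \<le> n" for n
  proof -
    \<comment> \<open>The exit to be used for \<open>n\<close>. It exists because
      \<open>n < \<nu> (Suc n)\<close>, and it is not 0 because
      \<open>\<nu> 1 \<le> n\<close>.\<close>
    define k where "k = (LEAST k. n < \<nu> (Suc k))"
    have k: "n < \<nu> (Suc k)"
      unfolding k_def using \<nu>(1) by (rule LeastI)
    have "k \<noteq> 0" using k n by (metis One_nat_def leD)
    \<comment> \<open>Otherwise \<open>k - 1\<close> would satisfy the condition that defines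
      \<open>k\<close>, against minimality.\<close>
    have "\<nu> k \<le> n"
    proof (rule ccontr)
      assume "\<not> \<nu> k \<le> n"
      then have "k \<le> k - 1"
        unfolding k_def using \<open>k \<noteq> 0\<close> k_def by (intro Least_le) auto
      with \<open>k \<noteq> 0\<close> show False by simp
    qed
    then have \<alpha>: "k + 1 \<le> n" "\<alpha> n * real r ^ n < real r ^ (n - k - 1)"
      using \<nu>(2)[of k n] \<open>k \<noteq> 0\<close> by auto
    have "r ^ (n - k - 1) \<le> card (reach act 0 n)"
      unfolding act_def using \<alpha>(1) k \<open>k \<noteq> 0\<close>
      by (intro reach(5)[of k]) (auto simp: \<mu>_def)
    then have "real r ^ (n - k - 1) \<le> real (growth M \<epsilon> n)"
      unfolding M_def \<epsilon>_def growth_action_module by (simp flip: of_nat_power)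
    with \<alpha>(2) show ?thesis by linarith
  qed
  then have "\<forall>\<^sub>F n in sequentially. real (growth M \<epsilon> n) > \<alpha> n * real CARD('x) ^ n"
    unfolding r_def by (rule eventually_sequentiallyI)
  moreover have "carrier M = orbit M \<epsilon> UNIV"
    unfolding M_def \<epsilon>_def orbit_UNIV act_def reach(4) by simp
  moreover have "right_module class_ring M" "\<epsilon> \<in> carrier M" "b \<in> carrier M"
    by (simp_all add: M_def right_module_action)
  ultimately show ?thesis
    unfolding Let_def by blast
qed

end
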